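(* Let $0<\varepsilon<1/200$. There is $n_0(\varepsilon)$ such that for all $n\ge n_0(\varepsilon)$ the following holds. Let $\mathcal{H}$ be the $3$-uniform hypergraph with vertex set $\mathcal{P}(n)$ whose edges are the triples $\{A,B,C\}$ of distinct sets with $A\cup B=C$, with rooting function $f(\{A,B,C\})=C$ (the head of an edge is the union of the other two sets). If $\mathcal{F}\subseteq\mathcal{P}(n)$ satisfies $|\mathcal{F}|\ge (1+\varepsilon)\binom{n}{\lfloor n/2\rfloor}$, then $\mathcal{F}$ contains an $\left(\mathcal{F},n,\frac{\varepsilon^2}{10^{40}}n^2\right)$-eligible vertex.
   Context: For $\mathcal{F}\subseteq\mathcal{P}(n)$ and $C\in\mathcal{F}$, the head link graph $\mathrm{HL}_C(\mathcal{H}\cap\mathcal{F})$ is the graph on vertex set $\mathcal{F}$ whose edges are the pairs $\{A,B\}$ of sets in $\mathcal{F}$ such that $A,B,C$ are distinct and $A\cup B=C$. A set $C\in\mathcal{F}$ is $(\mathcal{F},s,t)$-eligible if $\mathrm{HL}_C(\mathcal{H}\cap\mathcal{F})$ has a subgraph with maximum degree at most $s$ and at least $t$ edges. *)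

theory Defs
  imports Complex_Main
begin

(* Graphs are pairs of a vertex set and a set of two-element edges, hypergraphs are given
   by their edge sets.  All sizes are taken with card, so degrees and edge counts are
   meaningful for finite graphs only; below, every vertex set is a subset of Pow {1..n}. *)

type_synonym 'a graph = "'a set \<times> 'a set set"

definition verts :: "'a graph \<Rightarrow> 'a set" where
  "verts G = fst G"

definition edges :: "'a graph \<Rightarrow> 'a set set" where
  "edges G = snd G"

definition simple_graph :: "'a graph \<Rightarrow> bool" where
  "simple_graph G \<longleftrightarrow> (\<forall>e\<in>edges G. e \<subseteq> verts G \<and> card e = 2)"

definition subgraph :: "'a graph \<Rightarrow> 'a graph \<Rightarrow> bool" where
  "subgraph G' G \<longleftrightarrow> simple_graph G' \<and> verts G' \<subseteq> verts G \<and> edges G' \<subseteq> edges G"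

definition degree :: "'a graph \<Rightarrow> 'a \<Rightarrow> nat" where
  "degree G v = card {e \<in> edges G. v \<in> e}"

definition max_degree_at_most :: "'a graph \<Rightarrow> nat \<Rightarrow> bool" where
  "max_degree_at_most G s \<longleftrightarrow> (\<forall>v\<in>verts G. degree G v \<le> s)"

definition induced_hypergraph :: "'a set set \<Rightarrow> 'a set \<Rightarrow> 'a set set" where
  "induced_hypergraph H F = {e \<in> H. e \<subseteq> F}"

definition head_link_graph ::
    "'a set set \<Rightarrow> ('a set \<Rightarrow> 'a) \<Rightarrow> 'a set \<Rightarrow> 'a \<Rightarrow> 'a graph" where
  "head_link_graph H f F C =
     (F, {{A, B} | A B. distinct [A, B, C] \<and> {A, B, C} \<in> induced_hypergraph H F
                        \<and> f {A, B, C} = C})"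

definition eligible ::
    "'a set set \<Rightarrow> ('a set \<Rightarrow> 'a) \<Rightarrow> 'a set \<Rightarrow> nat \<Rightarrow> real \<Rightarrow> 'a \<Rightarrow> bool" where
  "eligible H f F s t C \<longleftrightarrow>
     C \<in> F \<and>
     (\<exists>G. subgraph G (head_link_graph H f F C) \<and> max_degree_at_most G s
          \<and> real (card (edges G)) \<ge> t)"

definition union_hypergraph :: "nat \<Rightarrow> nat set set set" where
  "union_hypergraph n =
     {{A, B, C} | A B C. A \<in> Pow {1..n} \<and> B \<in> Pow {1..n} \<and> C \<in> Pow {1..n}
                         \<and> distinct [A, B, C] \<and> A \<union> B = C}"

definition union_head :: "'a set set \<Rightarrow> 'a set" where
  "union_head e = (THE C. \<exists>A B. e = {A, B, C} \<and> distinct [A, B, C] \<and> A \<union> B = C)"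

lemma union_head_eq:
  assumes "distinct [A, B, C]" "A \<union> B = C"
  shows "union_head {A, B, C} = C"
  unfolding union_head_def
proof (rule the_equality)
  show "\<exists>A' B'. {A, B, C} = {A', B', C} \<and> distinct [A', B', C] \<and> A' \<union> B' = C"
    by (rule exI[of _ A], rule exI[of _ B]) (use assms in simp)
next
  fix C' assume "\<exists>A' B'. {A, B, C} = {A', B', C'} \<and> distinct [A', B', C'] \<and> A' \<union> B' = C'"
  then obtain A' B' where *: "{A, B, C} = {A', B', C'}" "A' \<union> B' = C'" by (elim exE conjE)
  have "\<Union>{A, B, C} = A \<union> B \<union> C" by (simp add: Un_assoc)
  then have "\<Union>{A, B, C} = C" using assms(2) by simp
  moreover have "\<Union>{A', B', C'} = A' \<union> B' \<union> C'" by (simp add: Un_assoc)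
  then have "\<Union>{A', B', C'} = C'" using *(2) by simp
  ultimately show "C' = C" using *(1) by simp
qed

lemma union_hypergraph_iff:
  assumes "distinct [A, B, C]"
  shows "{A, B, C} \<in> union_hypergraph n \<and> union_head {A, B, C} = C \<longleftrightarrow>
         A \<subseteq> {1..n} \<and> B \<subseteq> {1..n} \<and> C \<subseteq> {1..n} \<and> A \<union> B = C" (is "?L \<longleftrightarrow> ?R")
proof
  assume L: ?L
  then obtain A' B' C' where eq: "{A, B, C} = {A', B', C'}"
      and sub: "A' \<subseteq> {1..n}" "B' \<subseteq> {1..n}" "C' \<subseteq> {1..n}"
      and d: "distinct [A', B', C']" and u: "A' \<union> B' = C'"
    unfolding union_hypergraph_def mem_Collect_eq Pow_iff by (elim exE conjE)
  have C: "C' = C" using L eq union_head_eq[OF d u] by simp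
  have "{A, B} = {A, B, C} - {C}"
    using assms by (simp add: insert_Diff_if)
  also have "\<dots> = {A', B', C'} - {C'}" by (simp only: eq C)
  also have "\<dots> = {A', B'}" using d by (simp add: insert_Diff_if)
  finally have "\<Union>{A, B} = \<Union>{A', B'}" by simp
  then have "A \<union> B = C" using u C by simp
  moreover have "C \<subseteq> {1..n}" using sub(3) C by simp
  ultimately show ?R by auto
next
  assume R: ?R
  have "{A, B, C} \<in> union_hypergraph n"
    unfolding union_hypergraph_def mem_Collect_eq Pow_iff
    by (rule exI[of _ A], rule exI[of _ B], rule exI[of _ C]) (use R assms in simp)
  then show ?L using union_head_eq[OF assms] R by simp
qed

lemma head_link_graph_union:
  assumes "F \<subseteq> Pow {1..n}" "C \<in> F"
  shows "head_link_graph (union_hypergraph n) union_head F C =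
           (F, {{A, B} | A B. A \<in> F \<and> B \<in> F \<and> distinct [A, B, C] \<and> A \<union> B = C})"
proof -
  have "(distinct [A, B, C] \<and> {A, B, C} \<in> induced_hypergraph (union_hypergraph n) F
          \<and> union_head {A, B, C} = C) \<longleftrightarrow>
        (A \<in> F \<and> B \<in> F \<and> distinct [A, B, C] \<and> A \<union> B = C)" for A B
  proof (cases "distinct [A, B, C] \<and> A \<in> F \<and> B \<in> F")
    case True
    then have "A \<subseteq> {1..n}" "B \<subseteq> {1..n}" "C \<subseteq> {1..n}" using assms by (meson PowD subsetD)+
    then have "{A, B, C} \<in> union_hypergraph n \<and> union_head {A, B, C} = C \<longleftrightarrow> A \<union> B = C"
      using union_hypergraph_iff[of A B C n] True by simp
    then show ?thesis
      using True assms(2) by (simp add: induced_hypergraph_def)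
  next
    case False
    then show ?thesis by (auto simp: induced_hypergraph_def)
  qed
  then show ?thesis unfolding head_link_graph_def by presburger
qed

end

theory Submission
  imports "HOL-Combinatorics.Multiset_Permutations" "HOL-Probability.Hoeffding"
    "HOL-Real_Asymp.Real_Asymp" Defs
begin

text \<open>
  Call \<open>C \<in> F\<close> rich if a random maximal chain going down from \<open>C\<close> meets \<open>F\<close> again with
  probability at least \<open>\<epsilon>/3\<close>. In a random maximal chain of the cube every member
  of \<open>F\<close> can be the lowest one, and these events are disjoint; hence, as in the LYM inequality, if
  no set were rich then \<open>(1 - \<epsilon>/3) * card F\<close> would be at most the middle binomial coefficient.
  So there is a rich set, even after \<open>F\<close> has been restricted to the layers within \<open>\<epsilon>n/100\<close> of the
  middle.

  Given a rich \<open>C\<close>, apply Katona's cycle method: some ordering of \<open>C\<close> has linearly many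
  starting points from which a short interval of the ordering can be removed from \<open>C\<close> to leave
  a member of \<open>F\<close>. Intervals with distant starting points are disjoint, so the corresponding
  members of \<open>F\<close> have union \<open>C\<close>. This gives quadratically many edges on at most \<open>n\<close> vertices, and
  the degree condition is automatic.
\<close>

section \<open>Lowest members of chains and an LYM-type inequality\<close>

text \<open>The ordering \<open>xs\<close> of \<open>C\<close> encodes the descending chain of the sets \<open>set (drop i xs)\<close>.\<close>

definition chain_hits :: "'a set set \<Rightarrow> 'a set \<Rightarrow> 'a list set" where
  "chain_hits F C = {xs \<in> permutations_of_set C. \<exists>i\<ge>1. i \<le> length xs \<and> set (drop i xs) \<in> F}"

lemma chain_hits_subset: "chain_hits F C \<subseteq> permutations_of_set C"
  by (auto simp: chain_hits_def)

lemma finite_chain_hits [simp]: "finite (chain_hits F C)"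
  using chain_hits_subset finite_permutations_of_set by (rule finite_subset)

text \<open>If the lengths differed, \<open>ys\<close> would be a proper suffix of
  \<open>ys'\<close>, and the chain below \<open>C'\<close> would meet \<open>F\<close> again in
  \<open>C\<close>. So a chain has only one lowest member.\<close>

lemma lowest_member_unique:
  assumes ys: "ys \<in> permutations_of_set C" "C \<in> F"
    and ys': "ys' \<in> permutations_of_set C'" "ys' \<notin> chain_hits F C'"
    and eq: "xs @ ys = xs' @ ys'" and le: "length ys \<le> length ys'"
  shows "C = C'"
proof -
  let ?i = "length ys' - length ys"
  have "ys = drop ?i ys'"
    using eq le by (auto simp: append_eq_append_conv2)
  moreover have "set ys = C"
    using ys by (auto dest: permutations_of_setD)
  ultimately have "set (drop ?i ys') \<in> F"
    using ys by metis
  moreover have "?i \<le> length ys'"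
    by simp
  ultimately have "\<not> 1 \<le> ?i"
    using ys' unfolding chain_hits_def by blast
  then have "?i = 0"
    by simp
  with \<open>ys = drop ?i ys'\<close> \<open>set ys = C\<close> ys' show ?thesis
    by (auto dest: permutations_of_setD)
qed

text \<open>A random ordering of \<open>X\<close> has \<open>C\<close> as the set of a suffix with
  probability \<open>1 / (card X choose card C)\<close>; the numerator is the conditional
  probability that no shorter suffix lies in \<open>F\<close>. The terms are thus probabilities of
  disjoint events: that \<open>C\<close> is the lowest member on the chain.\<close>

lemma lym_lowest_members:
  assumes X: "finite X" and F: "F \<subseteq> Pow X"
  shows "(\<Sum>C\<in>F. (1 - real (card (chain_hits F C)) / fact (card C)) / real (card X choose card C)) \<le> 1"
proof -
  let ?R = "\<lambda>C. permutations_of_set (X - C) \<times> (permutations_of_set C - chain_hits F C)"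
  define P where "P C = (\<lambda>(xs, ys). xs @ ys) ` ?R C" for C
  have finF: "finite F"
    using X F by (meson finite_Pow_iff finite_subset)
  have inj: "inj_on (\<lambda>(xs, ys). xs @ ys) (?R C)" for C
    by (auto simp: inj_on_def dest!: length_finite_permutations_of_set)
  have disj: "P C \<inter> P C' = {}" if CF: "C \<in> F" "C' \<in> F" "C \<noteq> C'" for C C'
  proof (rule ccontr)
    assume "P C \<inter> P C' \<noteq> {}"
    then obtain xs ys xs' ys' where "(xs, ys) \<in> ?R C" "(xs', ys') \<in> ?R C'" "xs @ ys = xs' @ ys'"
      by (auto simp: P_def)
    then show False
      using lowest_member_unique[of ys C F ys' C' xs xs'] lowest_member_unique[of ys' C' F ys C xs' xs]
        CF by (cases "length ys \<le> length ys'") auto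
  qed
  have sub: "(\<Union>C\<in>F. P C) \<subseteq> permutations_of_set X"
  proof safe
    fix C zs assume "C \<in> F" "zs \<in> P C"
    then obtain xs ys where "zs = xs @ ys" "xs \<in> permutations_of_set (X - C)"
      "ys \<in> permutations_of_set C"
      by (auto simp: P_def)
    then show "zs \<in> permutations_of_set X"
      using F \<open>C \<in> F\<close> by (auto simp: permutations_of_set_def)
  qed
  have finP: "finite (P C)" for C
    by (simp add: P_def)
  have cardP: "real (card (P C)) / fact (card X)
      = (1 - real (card (chain_hits F C)) / fact (card C)) / real (card X choose card C)"
    if "C \<in> F" for C
  proof -
    have C: "C \<subseteq> X" "finite C" "card C \<le> card X"
      using that F X by (auto intro: finite_subset card_mono)
    have le: "card (chain_hits F C) \<le> fact (card C)"
      using card_mono[OF _ chain_hits_subset[of F C]] C by simp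
    have "card (P C) = fact (card X - card C) * (fact (card C) - card (chain_hits F C))"
      using C X by (simp add: P_def card_image[OF inj] card_cartesian_product card_Diff_subset
          chain_hits_subset)
    then have "real (card (P C)) = fact (card X - card C) * (fact (card C) - real (card (chain_hits F C)))"
      using le by (simp add: of_nat_diff)
    moreover have "real (card X choose card C) = fact (card X) / (fact (card C) * fact (card X - card C))"
      using C by (simp add: binomial_fact)
    ultimately show ?thesis
      using C by (simp add: divide_simps) (simp add: algebra_simps)
  qed
  have "(\<Sum>C\<in>F. card (P C)) = card (\<Union>C\<in>F. P C)"
    using finF finP disj by (intro card_UN_disjoint[symmetric]) auto
  also have "\<dots> \<le> fact (card X)"
    using card_mono[OF _ sub] X by simp
  finally have "real (\<Sum>C\<in>F. card (P C)) / fact (card X) \<le> 1"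
    by (simp add: of_nat_le_iff[symmetric, where ?'a = real] del: of_nat_le_iff)
  then show ?thesis
    by (simp add: sum_divide_distrib cardP)
qed

section \<open>Averaging over rotations and counting distant positions\<close>

lemma bij_betw_rotate_permutations:
  "bij_betw (rotate j) (permutations_of_set C) (permutations_of_set C)"
proof -
  have "inj (rotate j)"
    unfolding rotate_def by (rule inj_fn[OF inj_rotate1])
  then have "inj_on (rotate j) (permutations_of_set C)"
    by (rule inj_on_subset) simp
  moreover have "rotate j ` permutations_of_set C \<subseteq> permutations_of_set C"
    by (auto simp: permutations_of_set_def)
  ultimately show ?thesis
    by (simp add: bij_betw_def endo_inj_surj)
qed

text \<open>Each rotation permutes the orderings, so for every \<open>j\<close> exactly
  \<open>card S\<close> of them are moved into \<open>S\<close>, and some ordering reaches the mean.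
  Since \<open>K\<close> is free, shifts whose interval could wrap around can be left out
  later.\<close>

lemma exists_many_rotations:
  assumes C: "finite C" and S: "S \<subseteq> permutations_of_set C"
  shows "\<exists>xs\<in>permutations_of_set C. K * card S \<le> card {j. j < K \<and> rotate j xs \<in> S} * fact (card C)"
proof (rule ccontr)
  let ?N = "\<lambda>xs. card {j. j < K \<and> rotate j xs \<in> S}" and ?P = "permutations_of_set C"
  assume "\<not> ?thesis"
  then have less: "?N xs * fact (card C) < K * card S" if "xs \<in> ?P" for xs
    using that by (auto simp: not_le)
  have "card {xs \<in> ?P. rotate j xs \<in> S} = card S" for j
  proof (rule bij_betw_same_card)
    have "S \<subseteq> rotate j ` ?P"
      using S bij_betw_imp_surj_on[OF bij_betw_rotate_permutations[of j C]] by simp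
    then have "rotate j ` {xs \<in> ?P. rotate j xs \<in> S} = S"
      by blast
    then show "bij_betw (rotate j) {xs \<in> ?P. rotate j xs \<in> S} S"
      by (rule bij_betw_subset[OF bij_betw_rotate_permutations, rotated]) auto
  qed
  then have "K * card S = (\<Sum>j<K. card {xs \<in> ?P. rotate j xs \<in> S})"
    by simp
  also have "\<dots> = (\<Sum>xs\<in>?P. ?N xs)"
    using sum_multicount_gen[of "{..<K}" ?P "\<lambda>j xs. rotate j xs \<in> S" "\<lambda>xs. ?N xs"] by simp
  finally have "K * card S * fact (card C) = (\<Sum>xs\<in>?P. ?N xs * fact (card C))"
    by (simp add: sum_distrib_right)
  also have "\<dots> < (\<Sum>xs\<in>?P. K * card S)"
    using C less by (intro sum_strict_mono) auto
  also have "\<dots> = K * card S * fact (card C)"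
    using C by simp
  finally show False by simp
qed

text \<open>Up to swapping, a pair from \<open>J\<close> is distant unless its entries differ by
  less than \<open>k\<close>, and each \<open>i\<close> has at most \<open>2 * k\<close> such close
  partners.\<close>

lemma card_distant_pairs:
  assumes J: "finite (J :: nat set)"
  shows "card J * card J \<le> 2 * card {(i, j). i \<in> J \<and> j \<in> J \<and> i + k \<le> j} + card J * (2 * k)"
proof -
  let ?P = "{(i, j). i \<in> J \<and> j \<in> J \<and> i + k \<le> j}"
  let ?N = "SIGMA i:J. {j \<in> J. i < j + k \<and> j < i + k}"
  have fin: "finite ?P" "finite ?N"
    using J by (auto intro: finite_subset[of _ "J \<times> J"])
  have "card {j \<in> J. i < j + k \<and> j < i + k} \<le> 2 * k" for i
  proof -
    have "{j \<in> J. i < j + k \<and> j < i + k} \<subseteq> {Suc i - k..<i + k}"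
      by auto
    then have "card {j \<in> J. i < j + k \<and> j < i + k} \<le> card {Suc i - k..<i + k}"
      by (intro card_mono) auto
    then show ?thesis by simp
  qed
  then have N: "card ?N \<le> card J * (2 * k)"
    using J sum_bounded_above[of J "\<lambda>i. card {j \<in> J. i < j + k \<and> j < i + k}" "2 * k"] by simp
  have "J \<times> J \<subseteq> ?P \<union> prod.swap ` ?P \<union> ?N"
    by (force simp: image_iff)
  then have "card (J \<times> J) \<le> card (?P \<union> prod.swap ` ?P \<union> ?N)"
    using fin by (intro card_mono) auto
  also have "\<dots> \<le> card ?P + card (prod.swap ` ?P) + card ?N"
    by (meson add_le_mono card_Un_le le_refl le_trans)
  also have "card (prod.swap ` ?P) = card ?P"
    by (intro card_image) auto
  finally show ?thesis
    using N by (simp add: card_cartesian_product)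
qed

section \<open>From many good rotations to many edges\<close>

text \<open>Let \<open>A j\<close> be what remains of \<open>C\<close> after removing a suitable
  interval of \<open>xs\<close> that starts at position \<open>j\<close>. Intervals starting at
  least \<open>k\<close> apart are disjoint, so their complements have union \<open>C\<close>; the
  hypothesis on \<open>t\<close> matches the count of such pairs.\<close>

lemma eligible_if_many_rotations:
  assumes F: "F \<subseteq> Pow {1..n}" and C: "C \<in> F" and F': "F' \<subseteq> F"
    and near: "\<And>A. A \<in> F' \<Longrightarrow> card C \<le> card A + k"
    and xs: "xs \<in> permutations_of_set C"
    and J: "J \<subseteq> {j. j < card C - k \<and> rotate j xs \<in> chain_hits F' C}"
    and t: "2 * t \<le> real (card J) * (real (card J) - 2 * real k)"
  shows "eligible (union_hypergraph n) union_head F n t C"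
proof -
  have xsC: "set xs = C" "distinct xs" and len: "length xs = card C"
    using xs by (auto dest: permutations_of_setD length_finite_permutations_of_set)
  have Cn: "card C \<le> n"
    using F C card_mono[of "{1..n}" C] by auto
  have finJ: "finite J" and cJ: "card J \<le> n"
  proof -
    have "J \<subseteq> {..<card C}" using J by auto
    then show "finite J" "card J \<le> n"
      using Cn card_mono[of "{..<card C}" J] by (auto intro: finite_subset)
  qed
  have "\<exists>i. 1 \<le> i \<and> i \<le> k \<and> set (drop (i + j) xs) \<union> set (take j xs) \<in> F'" if "j \<in> J" for j
  proof -
    have j: "j < card C - k" "rotate j xs \<in> chain_hits F' C"
      using that J by auto
    then obtain i where i: "1 \<le> i" "i \<le> card C" "set (drop i (rotate j xs)) \<in> F'"
      by (auto simp: chain_hits_def len)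
    \<comment> \<open>The interval is short because a member of \<open>F'\<close> has at most
      \<open>k\<close> elements fewer than \<open>C\<close>.\<close>
    have "card (set (drop i (rotate j xs))) = card C - i"
      using xsC len by (subst distinct_card) auto
    with near[OF i(3)] i have "i \<le> k" by linarith
    \<comment> \<open>As \<open>i + j < card C\<close>, the removed interval does not wrap around
      the end of \<open>xs\<close>.\<close>
    moreover have "drop i (rotate j xs) = drop (i + j) xs @ take j xs"
      using j \<open>i \<le> k\<close> len by (simp add: rotate_drop_take)
    ultimately show ?thesis using i by auto
  qed
  then obtain i where i: "\<And>j. j \<in> J \<Longrightarrow>
      1 \<le> i j \<and> i j \<le> k \<and> set (drop (i j + j) xs) \<union> set (take j xs) \<in> F'"
    by metis
  define A where "A j = set (drop (i j + j) xs) \<union> set (take j xs)" for j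
  have AF: "A j \<in> F" if "j \<in> J" for j
    using i[OF that] F' by (auto simp: A_def)
  have out: "xs ! j \<notin> A j" "xs ! j \<in> C" if "j \<in> J" for j
  proof -
    have j: "j < length xs" using that J len by auto
    then show "xs ! j \<in> C" using xsC by auto
    show "xs ! j \<notin> A j"
      using i[OF that] xsC(2) j
      by (auto simp: A_def in_set_conv_nth nth_eq_iff_index_eq)
  qed
  have "in": "xs ! j \<in> A j'" if "j \<in> J" "j < j'" for j j'
  proof -
    have "j < length xs" using that J len by auto
    with that show ?thesis by (auto simp: A_def in_set_conv_nth intro!: exI[of _ j])
  qed
  \<comment> \<open>The index \<open>j\<close> is recovered from \<open>A j\<close> as the first
    position whose entry is missing.\<close>
  have A_inj: "j = j'" if "j \<in> J" "j' \<in> J" "A j = A j'" for j j'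
    using that out(1) "in" by (metis linorder_neqE_nat)
  have un: "A j \<union> A j' = C" if "j \<in> J" "j' \<in> J" "j + k \<le> j'" for j j'
  proof -
    \<comment> \<open>Entries before position \<open>j'\<close> lie in \<open>A j'\<close>; those
      from \<open>j'\<close> on lie in \<open>A j\<close>, whose gap ends by
      \<open>j + k\<close>.\<close>
    have "set (drop j' xs) \<subseteq> set (drop (i j + j) xs)"
      using i[OF that(1)] that by (intro set_drop_subset_set_drop) auto
    moreover have "set (take j' xs) \<union> set (drop j' xs) = C"
      using xsC by (metis append_take_drop_id set_append)
    moreover have "A j \<subseteq> C" "A j' \<subseteq> C"
      using xsC by (auto simp: A_def dest: in_set_dropD in_set_takeD)
    ultimately show ?thesis
      by (auto simp: A_def)
  qed
  define Q where "Q = {(j, j'). j \<in> J \<and> j' \<in> J \<and> j + k \<le> j'}"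
  define E where "E = (\<lambda>(j, j'). {A j, A j'}) ` Q"
  \<comment> \<open>The inequality is strict because \<open>1 \<le> i j\<close> and
    \<open>i j \<le> k\<close> force \<open>k\<close> to be positive.\<close>
  have lt: "j < j'" if "(j, j') \<in> Q" for j j'
    using that i[of j] by (auto simp: Q_def)
  have "inj_on (\<lambda>(j, j'). {A j, A j'}) Q"
  proof (rule inj_onI, clarsimp)
    fix a b c d assume Q: "(a, b) \<in> Q" "(c, d) \<in> Q" and eq: "{A a, A b} = {A c, A d}"
    then have "A a = A c \<and> A b = A d \<or> A a = A d \<and> A b = A c"
      by (auto simp: doubleton_eq_iff)
    then show "a = c \<and> b = d"
      using Q lt[OF Q(1)] lt[OF Q(2)] A_inj[of a c] A_inj[of b d] A_inj[of a d] A_inj[of b c]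
      by (auto simp: Q_def)
  qed
  then have cardE: "card E = card Q"
    by (simp add: E_def card_image)
  have "2 * t \<le> 2 * real (card E)"
  proof -
    have "real (card J * card J) \<le> real (2 * card Q + card J * (2 * k))"
      unfolding Q_def using card_distant_pairs[OF finJ, of k] by (rule of_nat_mono)
    with t show ?thesis by (simp add: cardE algebra_simps)
  qed
  moreover have "max_degree_at_most (F, E) n"
    unfolding max_degree_at_most_def Defs.degree_def edges_def snd_conv
  proof
    fix v
    \<comment> \<open>An edge at \<open>v\<close> consists of \<open>v\<close> and some
      \<open>A j\<close>, so the degree is at most \<open>card J\<close>, hence at most
      \<open>n\<close>.\<close>
    have "{e \<in> E. v \<in> e} \<subseteq> (\<lambda>j. {v, A j}) ` J"
      by (auto simp: E_def Q_def)
    then have "card {e \<in> E. v \<in> e} \<le> card J"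
      using finJ by (meson card_image_le card_mono finite_imageI le_trans)
    then show "card {e \<in> E. v \<in> e} \<le> n"
      using cJ by simp
  qed
  moreover have "subgraph (F, E) (head_link_graph (union_hypergraph n) union_head F C)"
  proof -
    have e: "A j \<in> F" "A j' \<in> F" "distinct [A j, A j', C]" "A j \<union> A j' = C" if "(j, j') \<in> Q" for j j'
      using that lt[OF that] AF un out[of j] out[of j'] A_inj[of j j'] by (auto simp: Q_def)
    have "x \<in> {{A, B} | A B. A \<in> F \<and> B \<in> F \<and> distinct [A, B, C] \<and> A \<union> B = C}
        \<and> x \<subseteq> F \<and> card x = 2" if "x \<in> E" for x
    proof -
      obtain j j' where "x = {A j, A j'}" and Q: "(j, j') \<in> Q"
        using \<open>x \<in> E\<close> by (auto simp: E_def)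
      then show ?thesis
        using e[OF Q] by auto
    qed
    then have "E \<subseteq> {{A, B} | A B. A \<in> F \<and> B \<in> F \<and> distinct [A, B, C] \<and> A \<union> B = C}"
      and "simple_graph (F, E)"
      by (blast, simp add: simple_graph_def verts_def edges_def)
    then show ?thesis
      by (simp add: head_link_graph_union[OF F C] subgraph_def verts_def edges_def)
  qed
  ultimately show ?thesis
    using C unfolding eligible_def by (intro conjI exI[of _ "(F, E)"]) (auto simp: edges_def)
qed

section \<open>Concentration near the middle layer\<close>

lemma card_subsets_by_card:
  assumes "finite X"
  shows "card {A. A \<subseteq> X \<and> P (card A)} = (\<Sum>i | i \<le> card X \<and> P i. card X choose i)"
proof -
  have "{A. A \<subseteq> X \<and> P (card A)} = (\<Union>i\<in>{i. i \<le> card X \<and> P i}. {A. A \<subseteq> X \<and> card A = i})"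
    using assms by (auto intro: card_mono)
  also have "card \<dots> = (\<Sum>i | i \<le> card X \<and> P i. card {A. A \<subseteq> X \<and> card A = i})"
    using assms by (intro card_UN_disjoint) auto
  finally show ?thesis
    using assms by (simp add: n_subsets)
qed

text \<open>Divided by \<open>2 ^ n\<close>, the count is a two-sided tail of the binomial
  distribution with parameter \<open>1 / 2\<close>, to which Hoeffding's inequality applies.\<close>

lemma card_subsets_outer_layers:
  assumes n: "n > 0" and \<eta>: "\<eta> \<ge> 0"
  shows "real (card {A. A \<subseteq> {1..n} \<and> \<bar>real (card A) / n - 1 / 2\<bar> \<ge> \<eta>})
           \<le> 2 * exp (- 2 * real n * \<eta>\<^sup>2) * 2 ^ n"
proof -
  interpret binomial_distribution n "1 / 2"
    by unfold_locales auto
  let ?S = "{i. \<bar>real i / n - 1 / 2\<bar> \<ge> \<eta>}"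
  let ?I = "{i. i \<le> n \<and> \<bar>real i / n - 1 / 2\<bar> \<ge> \<eta>}"
  have "real (card {A. A \<subseteq> {1..n} \<and> \<bar>real (card A) / n - 1 / 2\<bar> \<ge> \<eta>}) = (\<Sum>i\<in>?I. real (n choose i))"
    using card_subsets_by_card[of "{1..n}" "\<lambda>i. \<bar>real i / n - 1 / 2\<bar> \<ge> \<eta>"] by simp
  also have "\<dots> = (\<Sum>i\<in>?I. pmf (binomial_pmf n (1 / 2)) i) * 2 ^ n"
    by (auto simp: sum_distrib_right power_add[symmetric] power_one_over intro!: sum.cong)
  also have "(\<Sum>i\<in>?I. pmf (binomial_pmf n (1 / 2)) i) = measure_pmf.prob (binomial_pmf n (1 / 2)) ?I"
    by (subst measure_measure_pmf_finite) auto
  also have "\<dots> \<le> measure_pmf.prob (binomial_pmf n (1 / 2)) ?S"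
    by (intro measure_pmf.finite_measure_mono) auto
  also have "\<dots> \<le> 2 * exp (- 2 * real n * \<eta>\<^sup>2)"
    using prob_abs_ge'[OF n \<eta>] by simp
  finally show ?thesis by simp
qed

lemma two_power_le_central_binomial: "2 ^ n \<le> (n + 1) * (n choose (n div 2))"
proof -
  have "2 ^ n = (\<Sum>k\<le>n. n choose k)"
    by (simp add: choose_row_sum)
  also have "\<dots> \<le> (\<Sum>k\<le>n. n choose (n div 2))"
    by (intro sum_mono binomial_maximum)
  finally show ?thesis by simp
qed

text \<open>Replacing \<open>2 ^ n\<close> by the middle coefficient costs a factor
  \<open>n + 1\<close>, which the exponential tail absorbs.\<close>

lemma outer_layers_negligible:
  assumes "\<eta> > 0" "\<delta> > 0"
  shows "\<forall>\<^sub>F n in sequentially.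
    real (card {A. A \<subseteq> {1..n} \<and> \<bar>real (card A) / n - 1 / 2\<bar> \<ge> \<eta>}) \<le> \<delta> * real (n choose (n div 2))"
proof -
  have "(\<lambda>n. 2 * (real n + 1) * exp (- 2 * real n * \<eta>\<^sup>2)) \<longlonglongrightarrow> 0"
    using assms by real_asymp
  then have "\<forall>\<^sub>F n in sequentially. 2 * (real n + 1) * exp (- 2 * real n * \<eta>\<^sup>2) < \<delta>"
    using assms by (auto dest: order_tendstoD)
  then show ?thesis
    using eventually_gt_at_top[of 0]
  proof eventually_elim
    case (elim n)
    have M: "(2::real) ^ n \<le> (real n + 1) * real (n choose (n div 2))"
      using of_nat_mono[OF two_power_le_central_binomial[of n], where ?'a = real] by (simp add: algebra_simps)
    have "real (card {A. A \<subseteq> {1..n} \<and> \<bar>real (card A) / n - 1 / 2\<bar> \<ge> \<eta>})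
        \<le> 2 * exp (- 2 * real n * \<eta>\<^sup>2) * 2 ^ n"
      using elim assms by (intro card_subsets_outer_layers) auto
    also have "\<dots> \<le> 2 * exp (- 2 * real n * \<eta>\<^sup>2) * ((real n + 1) * real (n choose (n div 2)))"
      by (intro mult_left_mono M) auto
    also have "\<dots> = (2 * (real n + 1) * exp (- 2 * real n * \<eta>\<^sup>2)) * real (n choose (n div 2))"
      by (simp add: algebra_simps)
    also have "\<dots> \<le> \<delta> * real (n choose (n div 2))"
      using elim by (intro mult_right_mono) auto
    finally show ?case .
  qed
qed

section \<open>Existence of a rich set\<close>

text \<open>If no set were rich, each term of the LYM-type sum would be at least
  \<open>(1 - p) / ?M\<close>, and a sum of at most 1 would bound \<open>card F\<close> too
  tightly.\<close>

lemma exists_rich_set: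
  assumes X: "finite X" and F: "F \<subseteq> Pow X" and p: "p \<le> 1"
    and large: "real (card X choose (card X div 2)) < (1 - p) * real (card F)"
  shows "\<exists>C\<in>F. p * fact (card C) \<le> real (card (chain_hits F C))"
proof (rule ccontr)
  let ?M = "real (card X choose (card X div 2))"
  assume "\<not> ?thesis"
  then have less: "real (card (chain_hits F C)) < p * fact (card C)" if "C \<in> F" for C
    using that by (auto simp: not_le)
  have "(1 - p) / ?M \<le> (1 - real (card (chain_hits F C)) / fact (card C)) / real (card X choose card C)"
    if "C \<in> F" for C
  proof (rule frac_le)
    have "C \<subseteq> X" using that F by auto
    then show "0 < real (card X choose card C)"
      using X by (simp add: card_mono)
    show "real (card X choose card C) \<le> ?M"
      by (simp add: binomial_maximum)
    show "1 - p \<le> 1 - real (card (chain_hits F C)) / fact (card C)"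
      using less[OF that] by (simp add: field_simps)
    with p show "0 \<le> 1 - real (card (chain_hits F C)) / fact (card C)" by linarith
  qed
  then have "(\<Sum>C\<in>F. (1 - p) / ?M)
      \<le> (\<Sum>C\<in>F. (1 - real (card (chain_hits F C)) / fact (card C)) / real (card X choose card C))"
    by (rule sum_mono)
  also have "\<dots> \<le> 1"
    by (rule lym_lowest_members[OF X F])
  finally have "(1 - p) * real (card F) \<le> ?M"
    by (simp add: field_simps)
  with large show False by simp
qed

section \<open>Choice of constants and conclusion\<close>

theorem theorem5:
  fixes \<epsilon> :: real
  assumes "0 < \<epsilon>" and "\<epsilon> < 1 / 200"
  shows "\<exists>n\<^sub>0::nat. \<forall>n\<ge>n\<^sub>0. \<forall>F. F \<subseteq> Pow {1..n} \<longrightarrow>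
           real (card F) \<ge> (1 + \<epsilon>) * real (n choose (n div 2)) \<longrightarrow>
           (\<exists>C\<in>F. eligible (union_hypergraph n) union_head F n
                    (\<epsilon>\<^sup>2 / 10 ^ 40 * (real n)\<^sup>2) C)"
proof -
  \<comment> \<open>The layers kept span less than
    \<open>2 * \<eta> * n = \<epsilon> * n / 50\<close>, small compared with the bound
    \<open>16 / 100 * (\<epsilon> * n)\<close> for \<open>card J\<close> below.\<close>
  define \<eta> where "\<eta> = \<epsilon> / 100"
  have "\<forall>\<^sub>F n in sequentially. n > 0 \<and> real (card {A. A \<subseteq> {1..n} \<and> \<bar>real (card A) / n - 1 / 2\<bar> \<ge> \<eta>})
      \<le> \<epsilon> / 2 * real (n choose (n div 2))"
    using assms by (intro eventually_conj outer_layers_negligible eventually_gt_at_top) (auto simp: \<eta>_def)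
  then obtain n\<^sub>0 where n\<^sub>0: "\<And>n. n \<ge> n\<^sub>0 \<Longrightarrow> n > 0 \<and>
      real (card {A. A \<subseteq> {1..n} \<and> \<bar>real (card A) / n - 1 / 2\<bar> \<ge> \<eta>}) \<le> \<epsilon> / 2 * real (n choose (n div 2))"
    by (auto simp: eventually_sequentially)
  show ?thesis
  proof (intro exI[of _ n\<^sub>0] allI impI)
    fix n F
    assume "n \<ge> n\<^sub>0" and F: "F \<subseteq> Pow {1..n}"
      and big: "real (card F) \<ge> (1 + \<epsilon>) * real (n choose (n div 2))"
    define M where "M = real (n choose (n div 2))"
    have n: "n > 0" and outer: "real (card {A. A \<subseteq> {1..n} \<and> \<bar>real (card A) / n - 1 / 2\<bar> \<ge> \<eta>}) \<le> \<epsilon> / 2 * M"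
      using n\<^sub>0[OF \<open>n \<ge> n\<^sub>0\<close>] by (auto simp: M_def)
    have "M > 0" by (simp add: M_def)
    \<comment> \<open>Chain hits are counted in \<open>F'\<close> rather than \<open>F\<close>, so
      that a set hit below \<open>C\<close> is only slightly smaller than \<open>C\<close>. The
      restriction costs half of the surplus \<epsilon>.\<close>
    define F' where "F' = {A \<in> F. \<bar>real (card A) / n - 1 / 2\<bar> < \<eta>}"
    have finF: "finite F" using F by (meson finite_Pow_iff finite_atLeastAtMost finite_subset)
    have F'F: "F' \<subseteq> F" by (auto simp: F'_def)
    have middle: "real n / 2 - \<eta> * n < card A" "card A < real n / 2 + \<eta> * n" if "A \<in> F'" for A
      using that n by (auto simp: F'_def abs_less_iff field_simps)
    have "card F \<le> card (F' \<union> {A. A \<subseteq> {1..n} \<and> \<bar>real (card A) / n - 1 / 2\<bar> \<ge> \<eta>})"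
      using F finF F'F by (intro card_mono) (auto simp: F'_def intro: finite_subset)
    also have "\<dots> \<le> card F' + card {A. A \<subseteq> {1..n} \<and> \<bar>real (card A) / n - 1 / 2\<bar> \<ge> \<eta>}"
      by (rule card_Un_le)
    finally have cF': "(1 + \<epsilon> / 2) * M \<le> real (card F')"
      using big outer by (simp add: M_def algebra_simps)
    have "M < (1 - \<epsilon> / 3) * ((1 + \<epsilon> / 2) * M)"
    proof -
      \<comment> \<open>The product below equals
        \<open>1 + (\<epsilon> - \<epsilon> * \<epsilon>) / 6\<close>.\<close>
      have "\<epsilon> * \<epsilon> < \<epsilon> * 1" using assms by (intro mult_strict_left_mono) auto
      then have "1 < (1 - \<epsilon> / 3) * (1 + \<epsilon> / 2)" by (simp add: algebra_simps)
      with \<open>M > 0\<close> show ?thesis by (metis mult.assoc mult_1 mult_less_cancel_right_pos)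
    qed
    also have "\<dots> \<le> (1 - \<epsilon> / 3) * real (card F')"
      using assms by (intro mult_left_mono cF') auto
    finally have "\<exists>C\<in>F'. \<epsilon> / 3 * fact (card C) \<le> real (card (chain_hits F' C))"
      using F F'F assms by (intro exists_rich_set[of "{1..n}"]) (auto simp: M_def)
    then obtain C where C: "C \<in> F'" and rich: "\<epsilon> / 3 * fact (card C) \<le> real (card (chain_hits F' C))"
      by blast
    have "finite C" using C F F'F by (meson PowD finite_atLeastAtMost finite_subset subsetD)
    define k where "k = nat \<lfloor>2 * \<eta> * n\<rfloor>"
    have k: "real k \<le> \<epsilon> * n / 50"
      using assms of_int_floor_le[of "2 * \<eta> * n"] by (simp add: k_def \<eta>_def)
    have near: "card C \<le> card A + k" if "A \<in> F'" for A
    proof -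
      have "real (card C) - real (card A) < 2 * \<eta> * n"
        using middle[OF C] middle[OF that] by simp
      then have "int (card C) - int (card A) \<le> \<lfloor>2 * \<eta> * n\<rfloor>"
        by (simp add: le_floor_iff)
      then show ?thesis by (simp add: k_def)
    qed
    obtain xs where xs: "xs \<in> permutations_of_set C" and many: "(card C - k) * card (chain_hits F' C)
        \<le> card {j. j < card C - k \<and> rotate j xs \<in> chain_hits F' C} * fact (card C)"
      using exists_many_rotations[OF \<open>finite C\<close> chain_hits_subset] by blast
    define J where "J = {j. j < card C - k \<and> rotate j xs \<in> chain_hits F' C}"
    have small: "\<epsilon> * n \<le> n / 200"
      using assms mult_right_mono[of \<epsilon> "1 / 200" "real n"] by simp
    have "real (card C - k) * (\<epsilon> / 3 * fact (card C)) \<le> real (card C - k) * real (card (chain_hits F' C))"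
      by (intro mult_left_mono rich) auto
    also have "\<dots> \<le> real (card J) * fact (card C)"
      using of_nat_mono[OF many, where ?'a = real] by (simp add: J_def)
    finally have "real (card C - k) * (\<epsilon> / 3) \<le> real (card J)"
      by simp
    \<comment> \<open>Here \<open>card C\<close> exceeds \<open>n / 2 - \<epsilon> * n / 100\<close>
      and \<open>k\<close> is at most \<open>\<epsilon> * n / 50\<close>, with \<epsilon> below
      \<open>1 / 200\<close>. Multiplying 48/100 by \<open>\<epsilon> / 3\<close> gives the 16/100
      for \<open>J\<close>.\<close>
    moreover have "real n * (48 / 100) \<le> real (card C - k)"
      using middle(1)[OF C] k small by (simp add: \<eta>_def)
    then have "real n * (48 / 100) * (\<epsilon> / 3) \<le> real (card C - k) * (\<epsilon> / 3)"
      using assms by (intro mult_right_mono) auto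
    ultimately have J: "16 / 100 * (\<epsilon> * n) \<le> real (card J)"
      by (simp add: algebra_simps)
    \<comment> \<open>The factor 12/100 is 16/100 minus the 4/100 that bounds
      \<open>2 * real k\<close>.\<close>
    have "2 * (\<epsilon>\<^sup>2 / 10 ^ 40 * (real n)\<^sup>2) \<le> (16 / 100 * (\<epsilon> * n)) * (12 / 100 * (\<epsilon> * n))"
      using zero_le_square[of "\<epsilon> * n"] by (simp add: power2_eq_square algebra_simps)
    also have "\<dots> \<le> real (card J) * (real (card J) - 2 * real k)"
      using J k assms by (intro mult_mono) auto
    finally have "eligible (union_hypergraph n) union_head F n (\<epsilon>\<^sup>2 / 10 ^ 40 * (real n)\<^sup>2) C"
      using C F'F near xs by (intro eligible_if_many_rotations[OF F, where F' = F' and J = J]) (auto simp: J_def)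
    then show "\<exists>C\<in>F. eligible (union_hypergraph n) union_head F n (\<epsilon>\<^sup>2 / 10 ^ 40 * (real n)\<^sup>2) C"
      using C F'F by blast
  qed
qed

end
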